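(* Let $u$ be a sufficiently smooth solution (it suffices that $u\in C^{10}$) of the two-dimensional Helmholtz equation $\partial_x^2u+\partial_y^2u+K^2u=f$ on a rectangle $\Omega\subset\mathbb{R}^2$, where $K$ is a constant and $f$ is correspondingly smooth. Put $$\alpha_1=1+\frac{K^6h^6}{20160},\quad \alpha_2=\frac{h^2}{6}\left(1+\frac{K^2h^2}{30}+\frac{K^4h^4}{840}\right),\quad \alpha_3=1-\frac{K^2h^2}{12}+\frac{K^4h^4}{360},$$ $$\beta_1=1-\frac{K^2h^2}{12}+\frac{K^4h^4}{360},\quad \beta_2=\frac{K^4h^6}{20160},\quad \beta_3=\frac{h^4}{90}\left(1+\frac{K^2h^2}{112}\right),$$ $$\beta_4=\frac{h^2}{12}\left(1-\frac{K^2h^2}{30}\right),\quad \beta_5=\frac{h^4}{360}\left(1-\frac{K^2h^2}{56}\right).$$ Then at every interior grid point of a uniform grid of step size $h$ on $\Omega$, as $h\to0$, $$\alpha_1(\delta_x^2+\delta_y^2)u+\alpha_2\delta_x^2\delta_y^2u+K^2\alpha_3u=\beta_1f+\beta_2(\delta_x^2+\delta_y^2)f+\beta_3\delta_x^2\delta_y^2f+\beta_4(\partial_x^2+\partial_y^2)f+\beta_5(\delta_x^2\partial_x^2+\delta_y^2\partial_y^2)f+T+O(h^8),$$ where $$T=\frac{h^6}{3024}\partial_x^4\partial_y^4u-\frac{11h^6}{60480}(\partial_x^6+\partial_y^6)f-\frac{31h^6}{60480}(\partial_x^4\partial_y^2+\partial_x^2\partial_y^4)f.$$ In particular the leading truncation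 error term $T$ is of order $h^6$ and does not contain $K$ explicitly.
   Context: For a function $\varphi$ and step size $h>0$: $\delta_x^2\varphi(x,y)=\frac{\varphi(x-h,y)-2\varphi(x,y)+\varphi(x+h,y)}{h^2}$, $\delta_y^2\varphi(x,y)=\frac{\varphi(x,y-h)-2\varphi(x,y)+\varphi(x,y+h)}{h^2}$, and $\delta_x^2\delta_y^2$ is their composition (a 9-point stencil). $\partial_x^{r}\partial_y^{s}\varphi$ denotes the partial derivative of order $r$ in $x$ and $s$ in $y$. The constant implied in $O(h^8)$ may depend on $K,u,f$ but not on $h$. *)

theory Defs
  imports "HOL-Analysis.Analysis"
begin

text \<open>
  Derivatives are taken within the slices of \<open>\<Omega>\<close>. For the closed rectangle
  \<open>{a..b} \<times> {c..d}\<close> (with \<open>a < b\<close>, \<open>c < d\<close>) this is the ordinary partial derivative, one-sided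
  at the sides; stencils at interior grid points next to the boundary sample
  derivatives of \<open>f\<close> there.
\<close>

definition pdx :: "(real \<times> real) set \<Rightarrow> (real \<times> real \<Rightarrow> real) \<Rightarrow> real \<times> real \<Rightarrow> real" where
  "pdx \<Omega> \<phi> = (\<lambda>(x, y). vector_derivative (\<lambda>t. \<phi> (t, y)) (at x within {t. (t, y) \<in> \<Omega>}))"

definition pdy :: "(real \<times> real) set \<Rightarrow> (real \<times> real \<Rightarrow> real) \<Rightarrow> real \<times> real \<Rightarrow> real" where
  "pdy \<Omega> \<phi> = (\<lambda>(x, y). vector_derivative (\<lambda>t. \<phi> (x, t)) (at y within {t. (x, t) \<in> \<Omega>}))"

definition pd :: "(real \<times> real) set \<Rightarrow> nat \<Rightarrow> nat \<Rightarrow> (real \<times> real \<Rightarrow> real) \<Rightarrow> real \<times> real \<Rightarrow> real" where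
  "pd \<Omega> r s \<phi> = (pdx \<Omega> ^^ r) ((pdy \<Omega> ^^ s) \<phi>)"

definition has_partials_on :: "(real \<times> real \<Rightarrow> real) \<Rightarrow> (real \<times> real) set \<Rightarrow> bool" where
  "has_partials_on \<phi> \<Omega> \<longleftrightarrow> (\<forall>(x, y) \<in> \<Omega>.
     (\<lambda>t. \<phi> (t, y)) differentiable (at x within {t. (t, y) \<in> \<Omega>}) \<and>
     (\<lambda>t. \<phi> (x, t)) differentiable (at y within {t. (x, t) \<in> \<Omega>}))"

text \<open>All iterated partial derivatives of order at most \<open>k\<close>, in every order of
  differentiation, exist and are continuous on \<open>\<Omega>\<close>.\<close>

primrec Ck_on :: "nat \<Rightarrow> (real \<times> real) set \<Rightarrow> (real \<times> real \<Rightarrow> real) \<Rightarrow> bool" where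
  "Ck_on 0 \<Omega> \<phi> \<longleftrightarrow> continuous_on \<Omega> \<phi>"
| "Ck_on (Suc k) \<Omega> \<phi> \<longleftrightarrow> continuous_on \<Omega> \<phi> \<and> has_partials_on \<phi> \<Omega> \<and>
     Ck_on k \<Omega> (pdx \<Omega> \<phi>) \<and> Ck_on k \<Omega> (pdy \<Omega> \<phi>)"

definition uniform_grid :: "real \<times> real \<Rightarrow> real \<Rightarrow> (real \<times> real) set \<Rightarrow> (real \<times> real) set" where
  "uniform_grid q h \<Omega> = {(fst q + of_int i * h, snd q + of_int j * h) | i j. True} \<inter> \<Omega>"

text \<open>A grid point is interior if its whole 9-point stencil consists of grid points. If the grid
  lines include the sides of a rectangle \<open>\<Omega>\<close>, these are the grid points in the topological
  interior of \<open>\<Omega>\<close>.\<close>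

definition interior_grid_points :: "real \<times> real \<Rightarrow> real \<Rightarrow> (real \<times> real) set \<Rightarrow> (real \<times> real) set" where
  "interior_grid_points q h \<Omega> =
     {(x, y). {x - h, x, x + h} \<times> {y - h, y, y + h} \<subseteq> uniform_grid q h \<Omega>}"

definition delta2x :: "real \<Rightarrow> (real \<times> real \<Rightarrow> real) \<Rightarrow> real \<times> real \<Rightarrow> real" where
  "delta2x h \<phi> = (\<lambda>(x, y). (\<phi> (x - h, y) - 2 * \<phi> (x, y) + \<phi> (x + h, y)) / h^2)"

definition delta2y :: "real \<Rightarrow> (real \<times> real \<Rightarrow> real) \<Rightarrow> real \<times> real \<Rightarrow> real" where
  "delta2y h \<phi> = (\<lambda>(x, y). (\<phi> (x, y - h) - 2 * \<phi> (x, y) + \<phi> (x, y + h)) / h^2)"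

definition alpha1 :: "real \<Rightarrow> real \<Rightarrow> real" where
  "alpha1 K h = 1 + K^6 * h^6 / 20160"

definition alpha2 :: "real \<Rightarrow> real \<Rightarrow> real" where
  "alpha2 K h = h^2 / 6 * (1 + K^2 * h^2 / 30 + K^4 * h^4 / 840)"

definition alpha3 :: "real \<Rightarrow> real \<Rightarrow> real" where
  "alpha3 K h = 1 - K^2 * h^2 / 12 + K^4 * h^4 / 360"

definition beta1 :: "real \<Rightarrow> real \<Rightarrow> real" where
  "beta1 K h = 1 - K^2 * h^2 / 12 + K^4 * h^4 / 360"

definition beta2 :: "real \<Rightarrow> real \<Rightarrow> real" where
  "beta2 K h = K^4 * h^6 / 20160"

definition beta3 :: "real \<Rightarrow> real \<Rightarrow> real" where
  "beta3 K h = h^4 / 90 * (1 + K^2 * h^2 / 112)"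

definition beta4 :: "real \<Rightarrow> real \<Rightarrow> real" where
  "beta4 K h = h^2 / 12 * (1 - K^2 * h^2 / 30)"

definition beta5 :: "real \<Rightarrow> real \<Rightarrow> real" where
  "beta5 K h = h^4 / 360 * (1 - K^2 * h^2 / 56)"

text \<open>There is deliberately no parameter \<open>K\<close>: the leading error term depends on it only
  through \<open>u\<close> and \<open>f\<close>.\<close>

definition leading_error ::
  "(real \<times> real) set \<Rightarrow> (real \<times> real \<Rightarrow> real) \<Rightarrow> (real \<times> real \<Rightarrow> real) \<Rightarrow> real \<Rightarrow> real \<times> real \<Rightarrow> real" where
  "leading_error \<Omega> u f h p =
     h^6 / 3024 * pd \<Omega> 4 4 u p
     - 11 * h^6 / 60480 * (pd \<Omega> 6 0 f p + pd \<Omega> 0 6 f p)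
     - 31 * h^6 / 60480 * (pd \<Omega> 4 2 f p + pd \<Omega> 2 4 f p)"

end

theory Submission
  imports Defs "HOL-Library.Landau_Symbols"
begin

text \<open>
  Write \<open>X\<close> and \<open>Y\<close> for the operators \<open>\<partial>\<^sub>x\<^sup>2\<close> and \<open>\<partial>\<^sub>y\<^sup>2\<close>. By Taylor's theorem the second
  difference quotients are power series in the commuting symbols \<open>X\<close> and \<open>Y\<close>,
  \<open>\<delta>\<^sub>x\<^sup>2 = X + h\<^sup>2 X\<^sup>2 / 12 + h\<^sup>4 X\<^sup>3 / 360 + h\<^sup>6 X\<^sup>4 / 20160 + O(h\<^sup>8)\<close>
  and likewise for \<open>y\<close> (lemmas \<open>delta2x_expansion\<close>, \<open>delta2y_expansion\<close>), and the mixed difference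
  is the product of the two series (\<open>bigo_delta2x_delta2y\<close>). On solutions \<open>f\<close> is
  \<open>(X + Y + K\<^sup>2) u\<close>, and this may be differentiated (\<open>pd_Helmholtz\<close>). After these substitutions
  both sides of the scheme are polynomials in \<open>X\<close>, \<open>Y\<close>, \<open>K\<close>, \<open>h\<close> acting on \<open>u\<close>, and the
  coefficients are tuned so that the two polynomials agree, including the term \<open>T\<close>, modulo
  \<open>h\<^sup>8\<close>; the cofactor of \<open>h\<^sup>8\<close> is the explicit \<open>residual\<close> of lemma \<open>symbol_identity\<close>.

  The orders of smoothness are just enough. A coefficient of size \<open>h\<^sup>i\<close> asks for an expansion with
  remainder \<open>O(h\<^bsup>8-i\<^esup>)\<close>: \<open>\<delta>\<^sub>x\<^sup>2 u\<close> with coefficient \<open>O(1)\<close>, and \<open>\<delta>\<^sub>x\<^sup>2\<delta>\<^sub>y\<^sup>2 u\<close> with coefficient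
  \<open>O(h\<^sup>2)\<close>, both cost ten derivatives of \<open>u\<close>, and the terms in \<open>f\<close> cost at most eight of \<open>f\<close>.

  Since stencils may touch the boundary, everything takes place on the closed rectangle with one-sided
  derivatives. This is why Taylor's theorem and the symmetry of mixed derivatives (\<open>pdx_pdy_commute\<close>)
  are used for derivatives within a set. Uniformity in the grid comes from compactness: all
  remainders are bounded by suprema of continuous derivatives over the rectangle. It is expressed by
  Landau symbols along a filter on pairs of a step size and a point (\<open>stencil_filter\<close>).
\<close>

section \<open>Taylor expansion of the second difference quotient\<close>

text \<open>
  In the sum of the Taylor polynomials at \<open>x + h\<close> and \<open>x - h\<close> the odd terms cancel, so that
  a remainder of order \<open>2m + 2\<close> leaves an error \<open>h\<^bsup>2m\<^esup>\<close> after the division by \<open>h\<^sup>2\<close>. The case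
  \<open>m = 0\<close> says that the quotient is at most twice a bound of the second derivative; the mixed
  difference below needs it in this form.
\<close>

lemma second_difference_expansion:
  fixes g :: "nat \<Rightarrow> real \<Rightarrow> real"
  assumes deriv: "\<And>i t. t \<in> S \<Longrightarrow> i \<le> 2 * m + 1 \<Longrightarrow>
      (g i has_real_derivative g (Suc i) t) (at t within S)"
    and bound: "\<And>t. t \<in> S \<Longrightarrow> \<bar>g (2 * m + 2) t\<bar> \<le> B"
    and S: "convex S" "x - h \<in> S" "x \<in> S" "x + h \<in> S"
    and h: "h > 0"
  shows "\<bar>(g 0 (x - h) - 2 * g 0 x + g 0 (x + h)) / h^2
      - (\<Sum>j<m. 2 * h ^ (2 * j) / fact (2 * j + 2) * g (2 * j + 2) x)\<bar> \<le> 2 * B * h ^ (2 * m)"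
proof -
  define T where "T k = (\<Sum>i\<le>2 * m + 1. g i x * k ^ i / fact i)" for k
  have taylor: "\<bar>g 0 (x + k) - T k\<bar> \<le> B * h ^ (2 * m + 2)" if "x + k \<in> S" "\<bar>k\<bar> = h" for k
  proof -
    have "norm (g 0 (x + k) - (\<Sum>i\<le>2 * m + 1. g i x * ((x + k) - x) ^ i / fact i))
        \<le> B * norm ((x + k) - x) ^ Suc (2 * m + 1) / fact (2 * m + 1)"
      using that S deriv bound by (intro field_Taylor[where S = S]) auto
    then have "\<bar>g 0 (x + k) - T k\<bar> \<le> B * h ^ (2 * m + 2) / fact (2 * m + 1)"
      using that by (simp add: T_def)
    also have "\<dots> \<le> B * h ^ (2 * m + 2)"
    proof -
      have "0 \<le> B" using bound[of x] S by simp
      then have "0 \<le> B * h ^ (2 * m + 2)" using h by simp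
      then show ?thesis
        using fact_ge_1[of "2 * m + 1", where ?'a = real]
        by (simp add: divide_le_eq mult_le_cancel_left1 mult_left_le del: fact_Suc)
    qed
    finally show ?thesis .
  qed
  have even_part: "T h + T (- h) =
      2 * g 0 x + h^2 * (\<Sum>j<m. 2 * h ^ (2 * j) / fact (2 * j + 2) * g (2 * j + 2) x)"
    unfolding T_def
    by (induction m) (simp_all add: algebra_simps power2_eq_square add_divide_distrib flip: fact_Suc)
  have "\<bar>(g 0 (x - h) - 2 * g 0 x + g 0 (x + h))
      - h^2 * (\<Sum>j<m. 2 * h ^ (2 * j) / fact (2 * j + 2) * g (2 * j + 2) x)\<bar>
      \<le> 2 * (B * h ^ (2 * m + 2))"
    using taylor[of h] taylor[of "- h"] even_part S h by simp
  also have "\<dots> = h^2 * (2 * B * h ^ (2 * m))"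
    by (simp add: power_add power2_eq_square)
  finally have *: "\<bar>(g 0 (x - h) - 2 * g 0 x + g 0 (x + h))
      - h^2 * (\<Sum>j<m. 2 * h ^ (2 * j) / fact (2 * j + 2) * g (2 * j + 2) x)\<bar> / h^2
      \<le> 2 * B * h ^ (2 * m)"
    using h by (simp add: divide_le_eq mult.commute)
  have **: "\<bar>D - h^2 * \<Sigma>\<bar> / h^2 = \<bar>D / h^2 - \<Sigma>\<bar>" for D \<Sigma> :: real
  proof -
    have "\<bar>D - h^2 * \<Sigma>\<bar> / h^2 = \<bar>(D - h^2 * \<Sigma>) / h^2\<bar>"
      by simp
    also have "(D - h^2 * \<Sigma>) / h^2 = D / h^2 - \<Sigma>"
      using h by (simp add: diff_divide_distrib)
    finally show ?thesis .
  qed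
  show ?thesis
    using * unfolding ** .
qed

section \<open>Partial derivatives on a closed rectangle\<close>

lemma mvt_within:
  fixes g :: "real \<Rightarrow> real"
  assumes "s \<le> t" and "{s..t} \<subseteq> S"
    and "\<And>x. x \<in> S \<Longrightarrow> (g has_real_derivative g' x) (at x within S)"
  obtains \<xi> where "\<xi> \<in> {s..t}" "g t - g s = g' \<xi> * (t - s)"
proof -
  have "\<exists>\<xi>\<in>{s..t}. g t - g s = (\<lambda>v. g' \<xi> * v) (t - s)"
    using assms DERIV_subset[of g _ _ S "{s..t}"]
    by (intro mvt_very_simple) (auto simp: has_field_derivative_def[symmetric])
  with that show ?thesis by blast
qed

lemma pd_0_0: "pd \<Omega> 0 0 \<phi> = \<phi>"
  and pd_Suc: "pd \<Omega> (Suc r) s \<phi> = pdx \<Omega> (pd \<Omega> r s \<phi>)"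
  and pd_0_Suc: "pd \<Omega> 0 (Suc s) \<phi> = pdy \<Omega> (pd \<Omega> 0 s \<phi>)"
  by (simp_all add: pd_def)

locale closed_rectangle =
  fixes a b c d :: real and \<Omega> :: "(real \<times> real) set"
  assumes ab: "a < b" and cd: "c < d" and Omega: "\<Omega> = {a..b} \<times> {c..d}"
begin

lemma slices:
  "(x, y) \<in> \<Omega> \<Longrightarrow> {t. (t, y) \<in> \<Omega>} = {a..b}" "(x, y) \<in> \<Omega> \<Longrightarrow> {t. (x, t) \<in> \<Omega>} = {c..d}"
  by (auto simp: Omega)

lemma has_pdx:
  assumes "has_partials_on \<phi> \<Omega>" "(x, y) \<in> \<Omega>"
  shows "((\<lambda>t. \<phi> (t, y)) has_real_derivative pdx \<Omega> \<phi> (x, y)) (at x within {a..b})"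
  using assms vector_derivative_works[of "\<lambda>t. \<phi> (t, y)" "at x within {a..b}"] slices(1)[OF assms(2)]
  by (auto simp: has_partials_on_def pdx_def has_real_derivative_iff_has_vector_derivative)

lemma has_pdy:
  assumes "has_partials_on \<phi> \<Omega>" "(x, y) \<in> \<Omega>"
  shows "((\<lambda>t. \<phi> (x, t)) has_real_derivative pdy \<Omega> \<phi> (x, y)) (at y within {c..d})"
  using assms vector_derivative_works[of "\<lambda>t. \<phi> (x, t)" "at y within {c..d}"] slices(2)[OF assms(2)]
  by (auto simp: has_partials_on_def pdy_def has_real_derivative_iff_has_vector_derivative)

lemma pdx_eqI:
  assumes "((\<lambda>t. \<phi> (t, y)) has_real_derivative D) (at x within {a..b})" "(x, y) \<in> \<Omega>"
  shows "pdx \<Omega> \<phi> (x, y) = D"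
  using assms vector_derivative_within_closed_interval[OF ab, of x "\<lambda>t. \<phi> (t, y)" D] slices(1)[OF assms(2)]
  by (auto simp: pdx_def Omega has_real_derivative_iff_has_vector_derivative)

lemma pdy_eqI:
  assumes "((\<lambda>t. \<phi> (x, t)) has_real_derivative D) (at y within {c..d})" "(x, y) \<in> \<Omega>"
  shows "pdy \<Omega> \<phi> (x, y) = D"
  using assms vector_derivative_within_closed_interval[OF cd, of y "\<lambda>t. \<phi> (x, t)" D] slices(2)[OF assms(2)]
  by (auto simp: pdy_def Omega has_real_derivative_iff_has_vector_derivative)

lemma has_partials_onI:
  assumes "\<And>x y. (x, y) \<in> \<Omega> \<Longrightarrow>
      ((\<lambda>t. \<phi> (t, y)) has_real_derivative D (x, y)) (at x within {a..b})"
    and "\<And>x y. (x, y) \<in> \<Omega> \<Longrightarrow>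
      ((\<lambda>t. \<phi> (x, t)) has_real_derivative E (x, y)) (at y within {c..d})"
  shows "has_partials_on \<phi> \<Omega>"
  unfolding has_partials_on_def
proof (clarify, goal_cases)
  case (1 x y)
  then show ?case
    using assms[OF 1] unfolding slices[OF 1]
    by (auto intro: differentiableI simp: has_field_derivative_def)
qed

lemma pdx_cong:
  assumes "\<And>p. p \<in> \<Omega> \<Longrightarrow> \<phi> p = \<psi> p" and p: "p \<in> \<Omega>"
  shows "pdx \<Omega> \<phi> p = pdx \<Omega> \<psi> p"
proof -
  obtain x y where "p = (x, y)" by fastforce
  then show ?thesis
    using assms
    by (auto simp: pdx_def intro!: vector_derivative_cong_eq always_eventually)
qed

lemma pdy_cong:
  assumes "\<And>p. p \<in> \<Omega> \<Longrightarrow> \<phi> p = \<psi> p" and p: "p \<in> \<Omega>"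
  shows "pdy \<Omega> \<phi> p = pdy \<Omega> \<psi> p"
proof -
  obtain x y where "p = (x, y)" by fastforce
  then show ?thesis
    using assms
    by (auto simp: pdy_def intro!: vector_derivative_cong_eq always_eventually)
qed

text \<open>
  Congruence rules are restricted to \<open>\<Omega>\<close> because the identities between iterated derivatives,
  such as the symmetry of mixed derivatives, hold only there and not as equations of functions.
\<close>

lemma Ck_on_cong:
  assumes "\<And>p. p \<in> \<Omega> \<Longrightarrow> \<phi> p = \<psi> p"
  shows "Ck_on k \<Omega> \<phi> \<longleftrightarrow> Ck_on k \<Omega> \<psi>"
  using assms
proof (induction k arbitrary: \<phi> \<psi>)
  case 0
  then show ?case by (simp cong: continuous_on_cong)
next
  case (Suc k)
  have "has_partials_on \<psi> \<Omega>" if "has_partials_on \<phi> \<Omega>" "\<And>p. p \<in> \<Omega> \<Longrightarrow> \<phi> p = \<psi> p"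
    for \<phi> \<psi> :: "real \<times> real \<Rightarrow> real"
  proof (rule has_partials_onI)
    fix x y assume p: "(x, y) \<in> \<Omega>"
    then have xy: "x \<in> {a..b}" "y \<in> {c..d}"
      by (auto simp: Omega)
    show "((\<lambda>t. \<psi> (t, y)) has_real_derivative pdx \<Omega> \<phi> (x, y)) (at x within {a..b})"
      by (rule has_derivative_transform[OF xy(1) _ has_pdx[OF that(1) p, unfolded has_field_derivative_def],
          folded has_field_derivative_def])
        (use xy that(2) in \<open>auto simp: Omega\<close>)
    show "((\<lambda>t. \<psi> (x, t)) has_real_derivative pdy \<Omega> \<phi> (x, y)) (at y within {c..d})"
      by (rule has_derivative_transform[OF xy(2) _ has_pdy[OF that(1) p, unfolded has_field_derivative_def],
          folded has_field_derivative_def])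
        (use xy that(2) in \<open>auto simp: Omega\<close>)
  qed
  then have "has_partials_on \<phi> \<Omega> \<longleftrightarrow> has_partials_on \<psi> \<Omega>"
    using Suc.prems by metis
  moreover have "continuous_on \<Omega> \<phi> \<longleftrightarrow> continuous_on \<Omega> \<psi>"
    using Suc.prems by (simp cong: continuous_on_cong)
  moreover have "Ck_on k \<Omega> (pdx \<Omega> \<phi>) \<longleftrightarrow> Ck_on k \<Omega> (pdx \<Omega> \<psi>)"
    using Suc.prems by (intro Suc.IH pdx_cong)
  moreover have "Ck_on k \<Omega> (pdy \<Omega> \<phi>) \<longleftrightarrow> Ck_on k \<Omega> (pdy \<Omega> \<psi>)"
    using Suc.prems by (intro Suc.IH pdy_cong)
  ultimately show ?case by simp
qed

lemma Ck_on_Suc_imp: "Ck_on (Suc k) \<Omega> \<phi> \<Longrightarrow> Ck_on k \<Omega> \<phi>"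
proof (induction k arbitrary: \<phi>)
  case (Suc k)
  from Suc.prems have "Ck_on k \<Omega> (pdx \<Omega> \<phi>)" "Ck_on k \<Omega> (pdy \<Omega> \<phi>)"
    by (auto intro: Suc.IH simp only: Ck_on.simps(2)[of "Suc k"])
  with Suc.prems show ?case by (simp only: Ck_on.simps)
qed simp

lemma Ck_on_mono: "Ck_on n \<Omega> \<phi> \<Longrightarrow> k \<le> n \<Longrightarrow> Ck_on k \<Omega> \<phi>"
  by (induction n) (auto simp: le_Suc_eq simp del: Ck_on.simps dest: Ck_on_Suc_imp)

lemma Ck_on_funpow_pdx: "Ck_on (r + k) \<Omega> \<phi> \<Longrightarrow> Ck_on k \<Omega> ((pdx \<Omega> ^^ r) \<phi>)"
  by (induction r arbitrary: \<phi>) (simp_all add: funpow_swap1)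

lemma Ck_on_funpow_pdy: "Ck_on (s + k) \<Omega> \<phi> \<Longrightarrow> Ck_on k \<Omega> ((pdy \<Omega> ^^ s) \<phi>)"
  by (induction s arbitrary: \<phi>) (simp_all add: funpow_swap1)

lemma Ck_on_pd: "Ck_on n \<Omega> \<phi> \<Longrightarrow> r + s + k \<le> n \<Longrightarrow> Ck_on k \<Omega> (pd \<Omega> r s \<phi>)"
  unfolding pd_def by (intro Ck_on_funpow_pdx Ck_on_funpow_pdy) (erule Ck_on_mono, simp)

lemma has_partials_on_pd:
  assumes "Ck_on n \<Omega> \<phi>" "r + s < n"
  shows "has_partials_on (pd \<Omega> r s \<phi>) \<Omega>"
  using Ck_on_pd[OF assms(1), of r s 1] assms(2) by simp

lemma pd_bounded:
  assumes "Ck_on n \<Omega> \<phi>" "r + s \<le> n"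
  shows "\<exists>M. \<forall>p\<in>\<Omega>. \<bar>pd \<Omega> r s \<phi> p\<bar> \<le> M"
proof -
  have "continuous_on \<Omega> (pd \<Omega> r s \<phi>)"
    using Ck_on_pd[OF assms(1), of r s 0] assms(2) by simp
  moreover have "compact \<Omega>"
    by (simp add: Omega compact_Times)
  ultimately have "bounded (pd \<Omega> r s \<phi> ` \<Omega>)"
    by (intro compact_imp_bounded compact_continuous_image)
  then show ?thesis
    by (auto simp: bounded_iff)
qed

section \<open>Symmetry of mixed partial derivatives\<close>

text \<open>
  Schwarz's theorem up to the boundary. The second difference of \<open>\<phi>\<close> over the corners of a small
  rectangle, divided by the area, is by two applications of the mean value theorem a value of either
  mixed derivative in that rectangle, the order of the applications deciding which one. Hence both
  derivatives share values at points arbitrarily near \<open>p\<close>, and continuity makes them equal at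
  \<open>p\<close>. The point \<open>p\<close> is a corner of the small rectangle, chosen such that the rectangle lies
  in \<open>\<Omega>\<close> also if \<open>p\<close> is a boundary point.
\<close>

lemma pdx_pdy_commute:
  assumes "Ck_on 2 \<Omega> \<phi>" "p \<in> \<Omega>"
  shows "pdx \<Omega> (pdy \<Omega> \<phi>) p = pdy \<Omega> (pdx \<Omega> \<phi>) p"
proof -
  have ck: "has_partials_on \<phi> \<Omega>" "has_partials_on (pdx \<Omega> \<phi>) \<Omega>" "has_partials_on (pdy \<Omega> \<phi>) \<Omega>"
    and cont: "continuous_on \<Omega> (pdx \<Omega> (pdy \<Omega> \<phi>))" "continuous_on \<Omega> (pdy \<Omega> (pdx \<Omega> \<phi>))"
    using assms(1) by (simp_all add: numeral_2_eq_2)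
  obtain x y where p: "p = (x, y)" and x: "x \<in> {a..b}" and y: "y \<in> {c..d}"
    using assms(2) by (auto simp: Omega)
  have close: "\<exists>q\<in>\<Omega>. \<exists>q'\<in>\<Omega>. dist q p < \<delta> \<and> dist q' p < \<delta> \<and>
      pdx \<Omega> (pdy \<Omega> \<phi>) q = pdy \<Omega> (pdx \<Omega> \<phi>) q'" if "\<delta> > 0" for \<delta>
  proof -
    \<comment> \<open>Starting at \<open>z\<close>, or ending there if \<open>z\<close> is the right end point \<open>r\<close>.\<close>
    have short: "\<exists>s t. s < t \<and> {s..t} \<subseteq> {l..r} \<and> {s..t} \<subseteq> {z - \<delta> / 4..z + \<delta> / 4}"
      if "l < r" "z \<in> {l..r}" for l r z :: real
    proof (cases "z < r")
      case True
      with that \<open>\<delta> > 0\<close> show ?thesis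
        by (intro exI[of _ z] exI[of _ "min r (z + \<delta> / 4)"]) auto
    next
      case False
      with that \<open>\<delta> > 0\<close> show ?thesis
        by (intro exI[of _ "max l (z - \<delta> / 4)"] exI[of _ z]) auto
    qed
    from short[OF ab x] obtain x1 x2 where x12: "x1 < x2" "{x1..x2} \<subseteq> {a..b}"
      "{x1..x2} \<subseteq> {x - \<delta> / 4..x + \<delta> / 4}" by auto
    from short[OF cd y] obtain y1 y2 where y12: "y1 < y2" "{y1..y2} \<subseteq> {c..d}"
      "{y1..y2} \<subseteq> {y - \<delta> / 4..y + \<delta> / 4}" by auto
    have near: "dist (\<xi>, \<eta>) p < \<delta>" "(\<xi>, \<eta>) \<in> \<Omega>" if "\<xi> \<in> {x1..x2}" "\<eta> \<in> {y1..y2}" for \<xi> \<eta>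
    proof -
      have "\<xi> \<in> {x - \<delta> / 4..x + \<delta> / 4}" "\<eta> \<in> {y - \<delta> / 4..y + \<delta> / 4}"
        using that x12(3) y12(3) by blast+
      then have "dist \<xi> x \<le> \<delta> / 4" "dist \<eta> y \<le> \<delta> / 4"
        unfolding dist_real_def atLeastAtMost_iff by linarith+
      moreover have "dist (\<xi>, \<eta>) p \<le> dist \<xi> x + dist \<eta> y"
        by (simp add: p dist_Pair_Pair sqrt_sum_squares_le_sum)
      ultimately show "dist (\<xi>, \<eta>) p < \<delta>"
        using \<open>\<delta> > 0\<close> by linarith
      show "(\<xi>, \<eta>) \<in> \<Omega>"
        using that x12(2) y12(2) by (auto simp: Omega)
    qed
    have inx: "t \<in> {a..b}" if "t \<in> {x1..x2}" for t using that x12(2) by blast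
    have iny: "t \<in> {c..d}" if "t \<in> {y1..y2}" for t using that y12(2) by blast
    have ends: "x1 \<in> {a..b}" "x2 \<in> {a..b}" "y1 \<in> {c..d}" "y2 \<in> {c..d}"
      using inx[of x1] inx[of x2] iny[of y1] iny[of y2] x12(1) y12(1) by auto
    have dx: "((\<lambda>t. \<phi> (t, y2) - \<phi> (t, y1)) has_real_derivative
        pdx \<Omega> \<phi> (t, y2) - pdx \<Omega> \<phi> (t, y1)) (at t within {a..b})" if "t \<in> {a..b}" for t
      using that ends by (intro DERIV_diff has_pdx ck) (simp_all add: Omega)
    obtain \<xi> where \<xi>: "\<xi> \<in> {x1..x2}"
      "\<phi> (x2, y2) - \<phi> (x2, y1) - (\<phi> (x1, y2) - \<phi> (x1, y1))
        = (pdx \<Omega> \<phi> (\<xi>, y2) - pdx \<Omega> \<phi> (\<xi>, y1)) * (x2 - x1)"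
      by (rule mvt_within[OF less_imp_le[OF x12(1)] x12(2) dx])
    have dxy: "((\<lambda>t. pdx \<Omega> \<phi> (\<xi>, t)) has_real_derivative pdy \<Omega> (pdx \<Omega> \<phi>) (\<xi>, t))
        (at t within {c..d})" if "t \<in> {c..d}" for t
      using that inx[OF \<xi>(1)] by (intro has_pdy ck) (simp add: Omega)
    obtain \<eta> where \<eta>: "\<eta> \<in> {y1..y2}"
      "pdx \<Omega> \<phi> (\<xi>, y2) - pdx \<Omega> \<phi> (\<xi>, y1) = pdy \<Omega> (pdx \<Omega> \<phi>) (\<xi>, \<eta>) * (y2 - y1)"
      by (rule mvt_within[OF less_imp_le[OF y12(1)] y12(2) dxy])
    have dy: "((\<lambda>t. \<phi> (x2, t) - \<phi> (x1, t)) has_real_derivative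
        pdy \<Omega> \<phi> (x2, t) - pdy \<Omega> \<phi> (x1, t)) (at t within {c..d})" if "t \<in> {c..d}" for t
      using that ends by (intro DERIV_diff has_pdy ck) (simp_all add: Omega)
    obtain \<eta>' where \<eta>': "\<eta>' \<in> {y1..y2}"
      "\<phi> (x2, y2) - \<phi> (x1, y2) - (\<phi> (x2, y1) - \<phi> (x1, y1))
        = (pdy \<Omega> \<phi> (x2, \<eta>') - pdy \<Omega> \<phi> (x1, \<eta>')) * (y2 - y1)"
      by (rule mvt_within[OF less_imp_le[OF y12(1)] y12(2) dy])
    have dyx: "((\<lambda>t. pdy \<Omega> \<phi> (t, \<eta>')) has_real_derivative pdx \<Omega> (pdy \<Omega> \<phi>) (t, \<eta>'))
        (at t within {a..b})" if "t \<in> {a..b}" for t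
      using that iny[OF \<eta>'(1)] by (intro has_pdx ck) (simp add: Omega)
    obtain \<xi>' where \<xi>': "\<xi>' \<in> {x1..x2}"
      "pdy \<Omega> \<phi> (x2, \<eta>') - pdy \<Omega> \<phi> (x1, \<eta>') = pdx \<Omega> (pdy \<Omega> \<phi>) (\<xi>', \<eta>') * (x2 - x1)"
      by (rule mvt_within[OF less_imp_le[OF x12(1)] x12(2) dyx])
    have "pdx \<Omega> (pdy \<Omega> \<phi>) (\<xi>', \<eta>') * ((x2 - x1) * (y2 - y1))
        = pdy \<Omega> (pdx \<Omega> \<phi>) (\<xi>, \<eta>) * ((x2 - x1) * (y2 - y1))"
      using \<xi>(2) \<eta>'(2) unfolding \<eta>(2) \<xi>'(2) by (simp only: mult_ac)
    then have "pdx \<Omega> (pdy \<Omega> \<phi>) (\<xi>', \<eta>') = pdy \<Omega> (pdx \<Omega> \<phi>) (\<xi>, \<eta>)"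
      using x12(1) y12(1) by simp
    then show ?thesis
      using near[OF \<xi>(1) \<eta>(1)] near[OF \<xi>'(1) \<eta>'(1)] by blast
  qed
  show ?thesis
  proof (rule ccontr)
    define \<epsilon> where "\<epsilon> = dist (pdx \<Omega> (pdy \<Omega> \<phi>) p) (pdy \<Omega> (pdx \<Omega> \<phi>) p) / 2"
    assume "\<not> ?thesis"
    then have "\<epsilon> > 0" by (simp add: \<epsilon>_def)
    then obtain \<delta>1 \<delta>2 where \<delta>: "\<delta>1 > 0" "\<delta>2 > 0"
      "\<And>q. q \<in> \<Omega> \<Longrightarrow> dist q p < \<delta>1 \<Longrightarrow> dist (pdx \<Omega> (pdy \<Omega> \<phi>) q) (pdx \<Omega> (pdy \<Omega> \<phi>) p) < \<epsilon>"
      "\<And>q. q \<in> \<Omega> \<Longrightarrow> dist q p < \<delta>2 \<Longrightarrow> dist (pdy \<Omega> (pdx \<Omega> \<phi>) q) (pdy \<Omega> (pdx \<Omega> \<phi>) p) < \<epsilon>"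
      using cont assms(2) unfolding continuous_on_iff by metis
    obtain q q' where q: "q \<in> \<Omega>" "q' \<in> \<Omega>" "dist q p < min \<delta>1 \<delta>2" "dist q' p < min \<delta>1 \<delta>2"
      "pdx \<Omega> (pdy \<Omega> \<phi>) q = pdy \<Omega> (pdx \<Omega> \<phi>) q'"
      using close[of "min \<delta>1 \<delta>2"] \<delta>(1,2) by auto
    have "dist (pdx \<Omega> (pdy \<Omega> \<phi>) q) (pdx \<Omega> (pdy \<Omega> \<phi>) p) < \<epsilon>"
      "dist (pdx \<Omega> (pdy \<Omega> \<phi>) q) (pdy \<Omega> (pdx \<Omega> \<phi>) p) < \<epsilon>"
      using \<delta>(3)[of q] \<delta>(4)[of q'] q by auto
    then have "dist (pdx \<Omega> (pdy \<Omega> \<phi>) p) (pdy \<Omega> (pdx \<Omega> \<phi>) p) < 2 * \<epsilon>"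
      unfolding dist_real_def by linarith
    then show False by (simp add: \<epsilon>_def)
  qed
qed

lemma pdy_funpow_pdx:
  assumes "Ck_on (r + 1) \<Omega> \<phi>" "p \<in> \<Omega>"
  shows "pdy \<Omega> ((pdx \<Omega> ^^ r) \<phi>) p = (pdx \<Omega> ^^ r) (pdy \<Omega> \<phi>) p"
  using assms
proof (induction r arbitrary: p)
  case (Suc r)
  have "Ck_on 2 \<Omega> ((pdx \<Omega> ^^ r) \<phi>)"
    using Suc.prems(1) by (intro Ck_on_funpow_pdx) simp
  then have "pdy \<Omega> ((pdx \<Omega> ^^ Suc r) \<phi>) p = pdx \<Omega> (pdy \<Omega> ((pdx \<Omega> ^^ r) \<phi>)) p"
    using Suc.prems(2) by (simp add: pdx_pdy_commute)
  also have "\<dots> = pdx \<Omega> ((pdx \<Omega> ^^ r) (pdy \<Omega> \<phi>)) p"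
    using Suc.prems(2) Ck_on_mono[OF Suc.prems(1), of "r + 1"] by (intro pdx_cong Suc.IH) simp_all
  finally show ?case by simp
qed simp

lemma funpow_pdy_pdx_commute:
  assumes "Ck_on (r + s) \<Omega> \<phi>" "p \<in> \<Omega>"
  shows "(pdy \<Omega> ^^ s) ((pdx \<Omega> ^^ r) \<phi>) p = (pdx \<Omega> ^^ r) ((pdy \<Omega> ^^ s) \<phi>) p"
  using assms
proof (induction s arbitrary: p)
  case (Suc s)
  have "(pdy \<Omega> ^^ Suc s) ((pdx \<Omega> ^^ r) \<phi>) p = pdy \<Omega> ((pdx \<Omega> ^^ r) ((pdy \<Omega> ^^ s) \<phi>)) p"
    using Suc.prems(2) Ck_on_mono[OF Suc.prems(1), of "r + s"]
    by (simp add: pdy_cong[OF Suc.IH])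
  also have "\<dots> = (pdx \<Omega> ^^ r) (pdy \<Omega> ((pdy \<Omega> ^^ s) \<phi>)) p"
    using Suc.prems by (intro pdy_funpow_pdx Ck_on_funpow_pdy) (simp_all add: add_ac del: Ck_on.simps)
  finally show ?case by simp
qed simp

lemma funpow_pdx_cong:
  assumes "\<And>p. p \<in> \<Omega> \<Longrightarrow> \<phi> p = \<psi> p" "p \<in> \<Omega>"
  shows "(pdx \<Omega> ^^ r) \<phi> p = (pdx \<Omega> ^^ r) \<psi> p"
  using assms(2) by (induction r arbitrary: p) (auto simp: assms(1) intro!: pdx_cong)

lemma funpow_pdy_cong:
  assumes "\<And>p. p \<in> \<Omega> \<Longrightarrow> \<phi> p = \<psi> p" "p \<in> \<Omega>"
  shows "(pdy \<Omega> ^^ s) \<phi> p = (pdy \<Omega> ^^ s) \<psi> p"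
  using assms(2) by (induction s arbitrary: p) (auto simp: assms(1) intro!: pdy_cong)

lemma pd_cong:
  assumes "\<And>p. p \<in> \<Omega> \<Longrightarrow> \<phi> p = \<psi> p" "p \<in> \<Omega>"
  shows "pd \<Omega> r s \<phi> p = pd \<Omega> r s \<psi> p"
  using assms unfolding pd_def by (intro funpow_pdx_cong funpow_pdy_cong)

lemma pd_pd:
  assumes "Ck_on n \<Omega> \<phi>" "r + s + r' + s' \<le> n" "p \<in> \<Omega>"
  shows "pd \<Omega> r s (pd \<Omega> r' s' \<phi>) p = pd \<Omega> (r + r') (s + s') \<phi> p"
proof -
  have "Ck_on (r' + s) \<Omega> ((pdy \<Omega> ^^ s') \<phi>)"
    using assms(1,2) by (intro Ck_on_funpow_pdy) (erule Ck_on_mono, simp)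
  then have "pd \<Omega> r s (pd \<Omega> r' s' \<phi>) p = (pdx \<Omega> ^^ r) ((pdx \<Omega> ^^ r') ((pdy \<Omega> ^^ s) ((pdy \<Omega> ^^ s') \<phi>))) p"
    unfolding pd_def using assms(3) by (intro funpow_pdx_cong funpow_pdy_pdx_commute)
  then show ?thesis
    by (simp add: pd_def funpow_add)
qed

section \<open>Differentiating the Helmholtz equation\<close>

lemma lincomb_derivatives:
  fixes k :: real
  assumes "has_partials_on \<phi> \<Omega>" "has_partials_on \<psi> \<Omega>"
  shows "has_partials_on (\<lambda>p. \<phi> p + k * \<psi> p) \<Omega>"
    and "p \<in> \<Omega> \<Longrightarrow> pdx \<Omega> (\<lambda>p. \<phi> p + k * \<psi> p) p = pdx \<Omega> \<phi> p + k * pdx \<Omega> \<psi> p"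
    and "p \<in> \<Omega> \<Longrightarrow> pdy \<Omega> (\<lambda>p. \<phi> p + k * \<psi> p) p = pdy \<Omega> \<phi> p + k * pdy \<Omega> \<psi> p"
proof -
  have x: "((\<lambda>t. \<phi> (t, y) + k * \<psi> (t, y)) has_real_derivative
      pdx \<Omega> \<phi> (x, y) + k * pdx \<Omega> \<psi> (x, y)) (at x within {a..b})" if "(x, y) \<in> \<Omega>" for x y
    using that assms by (intro DERIV_add DERIV_cmult has_pdx)
  have y: "((\<lambda>t. \<phi> (x, t) + k * \<psi> (x, t)) has_real_derivative
      pdy \<Omega> \<phi> (x, y) + k * pdy \<Omega> \<psi> (x, y)) (at y within {c..d})" if "(x, y) \<in> \<Omega>" for x y
    using that assms by (intro DERIV_add DERIV_cmult has_pdy)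
  show "has_partials_on (\<lambda>p. \<phi> p + k * \<psi> p) \<Omega>"
    using x y by (rule has_partials_onI)
  show "pdx \<Omega> (\<lambda>p. \<phi> p + k * \<psi> p) p = pdx \<Omega> \<phi> p + k * pdx \<Omega> \<psi> p" if "p \<in> \<Omega>"
    using that x pdx_eqI[of "\<lambda>p. \<phi> p + k * \<psi> p"] by (cases p) auto
  show "pdy \<Omega> (\<lambda>p. \<phi> p + k * \<psi> p) p = pdy \<Omega> \<phi> p + k * pdy \<Omega> \<psi> p" if "p \<in> \<Omega>"
    using that y pdy_eqI[of "\<lambda>p. \<phi> p + k * \<psi> p"] by (cases p) auto
qed

lemma Ck_on_lincomb:
  fixes k :: real
  assumes "Ck_on n \<Omega> \<phi>" "Ck_on n \<Omega> \<psi>"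
  shows "Ck_on n \<Omega> (\<lambda>p. \<phi> p + k * \<psi> p)"
  using assms
proof (induction n arbitrary: \<phi> \<psi>)
  case 0
  then show ?case by (auto intro!: continuous_intros)
next
  case (Suc n)
  then have part: "has_partials_on \<phi> \<Omega>" "has_partials_on \<psi> \<Omega>" by auto
  have "Ck_on n \<Omega> (pdx \<Omega> (\<lambda>p. \<phi> p + k * \<psi> p)) \<longleftrightarrow>
      Ck_on n \<Omega> (\<lambda>p. pdx \<Omega> \<phi> p + k * pdx \<Omega> \<psi> p)"
    using part by (intro Ck_on_cong lincomb_derivatives)
  moreover have "Ck_on n \<Omega> (pdy \<Omega> (\<lambda>p. \<phi> p + k * \<psi> p)) \<longleftrightarrow>
      Ck_on n \<Omega> (\<lambda>p. pdy \<Omega> \<phi> p + k * pdy \<Omega> \<psi> p)"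
    using part by (intro Ck_on_cong lincomb_derivatives)
  ultimately show ?case
    using Suc lincomb_derivatives(1)[OF part] by (auto intro!: continuous_intros)
qed

lemma pd_lincomb:
  fixes k :: real
  assumes "Ck_on n \<Omega> \<phi>" "Ck_on n \<Omega> \<psi>" "r + s \<le> n" "p \<in> \<Omega>"
  shows "pd \<Omega> r s (\<lambda>p. \<phi> p + k * \<psi> p) p = pd \<Omega> r s \<phi> p + k * pd \<Omega> r s \<psi> p"
  using assms(3,4)
proof (induction r arbitrary: p)
  case 0
  then show ?case
  proof (induction s arbitrary: p)
    case (Suc s)
    have part: "has_partials_on (pd \<Omega> 0 s \<phi>) \<Omega>" "has_partials_on (pd \<Omega> 0 s \<psi>) \<Omega>"
      using Suc.prems assms(1,2) by (auto intro: has_partials_on_pd)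
    have "pd \<Omega> 0 (Suc s) (\<lambda>p. \<phi> p + k * \<psi> p) p = pdy \<Omega> (pd \<Omega> 0 s (\<lambda>p. \<phi> p + k * \<psi> p)) p"
      by (simp add: pd_def)
    also have "\<dots> = pdy \<Omega> (\<lambda>p. pd \<Omega> 0 s \<phi> p + k * pd \<Omega> 0 s \<psi> p) p"
      using Suc.prems by (intro pdy_cong Suc.IH) auto
    also have "\<dots> = pd \<Omega> 0 (Suc s) \<phi> p + k * pd \<Omega> 0 (Suc s) \<psi> p"
      unfolding lincomb_derivatives(3)[OF part Suc.prems(2)] by (simp add: pd_def)
    finally show ?case .
  qed (simp add: pd_def)
next
  case (Suc r)
  have part: "has_partials_on (pd \<Omega> r s \<phi>) \<Omega>" "has_partials_on (pd \<Omega> r s \<psi>) \<Omega>"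
    using Suc.prems assms(1,2) by (auto intro: has_partials_on_pd)
  have "pd \<Omega> (Suc r) s (\<lambda>p. \<phi> p + k * \<psi> p) p = pdx \<Omega> (pd \<Omega> r s (\<lambda>p. \<phi> p + k * \<psi> p)) p"
    by (simp add: pd_def)
  also have "\<dots> = pdx \<Omega> (\<lambda>p. pd \<Omega> r s \<phi> p + k * pd \<Omega> r s \<psi> p) p"
    using Suc.prems by (intro pdx_cong Suc.IH) auto
  also have "\<dots> = pd \<Omega> (Suc r) s \<phi> p + k * pd \<Omega> (Suc r) s \<psi> p"
    unfolding lincomb_derivatives(2)[OF part Suc.prems(2)] by (simp add: pd_def)
  finally show ?case .
qed

lemma pd_Helmholtz:
  assumes u: "Ck_on (n + 2) \<Omega> u" and "r + s \<le> n" "p \<in> \<Omega>"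
    and eq: "\<And>p. p \<in> \<Omega> \<Longrightarrow> pd \<Omega> 2 0 u p + pd \<Omega> 0 2 u p + k * u p = f p"
  shows "pd \<Omega> r s f p = pd \<Omega> (r + 2) s u p + pd \<Omega> r (s + 2) u p + k * pd \<Omega> r s u p"
proof -
  let ?L = "\<lambda>p. pd \<Omega> 2 0 u p + 1 * pd \<Omega> 0 2 u p"
  have ck: "Ck_on n \<Omega> (pd \<Omega> 2 0 u)" "Ck_on n \<Omega> (pd \<Omega> 0 2 u)" "Ck_on n \<Omega> u"
    using Ck_on_pd[OF u, of 2 0 n] Ck_on_pd[OF u, of 0 2 n] Ck_on_mono[OF u, of n] by auto
  have "pd \<Omega> r s f p = pd \<Omega> r s (\<lambda>p. ?L p + k * u p) p"
    using assms(3) by (intro pd_cong) (simp_all add: eq)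
  also have "\<dots> = pd \<Omega> r s ?L p + k * pd \<Omega> r s u p"
    using assms ck by (intro pd_lincomb Ck_on_lincomb)
  also have "pd \<Omega> r s ?L p = pd \<Omega> r s (pd \<Omega> 2 0 u) p + 1 * pd \<Omega> r s (pd \<Omega> 0 2 u) p"
    using assms ck by (intro pd_lincomb)
  finally show ?thesis
    using assms by (simp add: pd_pd[OF u])
qed

section \<open>Expansion of the difference operators\<close>

lemma delta2x_expansion:
  assumes "Ck_on (2 * m + 2) \<Omega> \<phi>"
  shows "\<exists>C. \<forall>h>0. \<forall>x y. {x - h, x, x + h} \<times> {y} \<subseteq> \<Omega> \<longrightarrow>
    \<bar>delta2x h \<phi> (x, y)
      - (\<Sum>j<m. 2 * h ^ (2 * j) / fact (2 * j + 2) * pd \<Omega> (2 * j + 2) 0 \<phi> (x, y))\<bar> \<le> C * h ^ (2 * m)"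
proof -
  obtain M where M: "\<And>p. p \<in> \<Omega> \<Longrightarrow> \<bar>pd \<Omega> (2 * m + 2) 0 \<phi> p\<bar> \<le> M"
    using pd_bounded[OF assms, of "2 * m + 2" 0] by auto
  have "\<bar>delta2x h \<phi> (x, y)
      - (\<Sum>j<m. 2 * h ^ (2 * j) / fact (2 * j + 2) * pd \<Omega> (2 * j + 2) 0 \<phi> (x, y))\<bar> \<le> 2 * M * h ^ (2 * m)"
    if h: "h > 0" and xy: "{x - h, x, x + h} \<times> {y} \<subseteq> \<Omega>" for h x y
  proof -
    have S: "x - h \<in> {a..b}" "x \<in> {a..b}" "x + h \<in> {a..b}" "y \<in> {c..d}"
      using xy by (auto simp: Omega)
    have deriv: "((\<lambda>t. pd \<Omega> i 0 \<phi> (t, y)) has_real_derivative pd \<Omega> (Suc i) 0 \<phi> (t, y)) (at t within {a..b})"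
      if "t \<in> {a..b}" "i \<le> 2 * m + 1" for i t
      using that S(4) has_pdx[OF has_partials_on_pd[OF assms, of i 0], of t y]
      by (auto simp: pd_Suc Omega)
    have bound: "\<bar>pd \<Omega> (2 * m + 2) 0 \<phi> (t, y)\<bar> \<le> M" if "t \<in> {a..b}" for t
      using M that S(4) by (simp add: Omega)
    show ?thesis
      using second_difference_expansion[of "{a..b}" m "\<lambda>i t. pd \<Omega> i 0 \<phi> (t, y)" M,
          OF deriv bound convex_real_interval(5) S(1-3) h]
      unfolding delta2x_def prod.case pd_0_0 .
  qed
  then show ?thesis by blast
qed

lemma delta2y_expansion:
  assumes "Ck_on (2 * m + 2) \<Omega> \<phi>"
  shows "\<exists>C. \<forall>h>0. \<forall>x y. {x} \<times> {y - h, y, y + h} \<subseteq> \<Omega> \<longrightarrow>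
    \<bar>delta2y h \<phi> (x, y)
      - (\<Sum>j<m. 2 * h ^ (2 * j) / fact (2 * j + 2) * pd \<Omega> 0 (2 * j + 2) \<phi> (x, y))\<bar> \<le> C * h ^ (2 * m)"
proof -
  obtain M where M: "\<And>p. p \<in> \<Omega> \<Longrightarrow> \<bar>pd \<Omega> 0 (2 * m + 2) \<phi> p\<bar> \<le> M"
    using pd_bounded[OF assms, of 0 "2 * m + 2"] by auto
  have "\<bar>delta2y h \<phi> (x, y)
      - (\<Sum>j<m. 2 * h ^ (2 * j) / fact (2 * j + 2) * pd \<Omega> 0 (2 * j + 2) \<phi> (x, y))\<bar> \<le> 2 * M * h ^ (2 * m)"
    if h: "h > 0" and xy: "{x} \<times> {y - h, y, y + h} \<subseteq> \<Omega>" for h x y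
  proof -
    have S: "y - h \<in> {c..d}" "y \<in> {c..d}" "y + h \<in> {c..d}" "x \<in> {a..b}"
      using xy by (auto simp: Omega)
    have deriv: "((\<lambda>t. pd \<Omega> 0 i \<phi> (x, t)) has_real_derivative pd \<Omega> 0 (Suc i) \<phi> (x, t)) (at t within {c..d})"
      if "t \<in> {c..d}" "i \<le> 2 * m + 1" for i t
      using that S(4) has_pdy[OF has_partials_on_pd[OF assms, of 0 i], of x t]
      by (auto simp: pd_0_Suc Omega)
    have bound: "\<bar>pd \<Omega> 0 (2 * m + 2) \<phi> (x, t)\<bar> \<le> M" if "t \<in> {c..d}" for t
      using M that S(4) by (simp add: Omega)
    show ?thesis
      using second_difference_expansion[of "{c..d}" m "\<lambda>i t. pd \<Omega> 0 i \<phi> (x, t)" M,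
          OF deriv bound convex_real_interval(5) S(1-3) h]
      unfolding delta2y_def prod.case pd_0_0 .
  qed
  then show ?thesis by blast
qed

text \<open>
  Expanding \<open>\<delta>\<^sub>y\<^sup>2 \<phi>\<close> and applying \<open>\<delta>\<^sub>x\<^sup>2\<close> to the remainder directly would lose a factor
  \<open>h\<^sup>2\<close>. Instead the second \<open>x\<close>-derivative of that remainder is recognised as the remainder in the
  expansion of \<open>\<delta>\<^sub>y\<^sup>2 \<partial>\<^sub>x\<^sup>2 \<phi>\<close>, hence of size \<open>h\<^bsup>2m\<^esup>\<close>, and \<open>\<delta>\<^sub>x\<^sup>2\<close> of a function is bounded by
  twice the supremum of its second derivative.
\<close>

lemma delta2x_delta2y_expansion:
  assumes "Ck_on (2 * m + 4) \<Omega> \<phi>"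
  shows "\<exists>C. \<forall>h>0. \<forall>x y. {x - h, x, x + h} \<times> {y - h, y, y + h} \<subseteq> \<Omega> \<longrightarrow>
    \<bar>delta2x h (delta2y h \<phi>) (x, y)
      - (\<Sum>j<m. 2 * h ^ (2 * j) / fact (2 * j + 2) * delta2x h (pd \<Omega> 0 (2 * j + 2) \<phi>) (x, y))\<bar>
    \<le> C * h ^ (2 * m)"
proof -
  define \<gamma> :: "real \<Rightarrow> nat \<Rightarrow> real" where "\<gamma> h j = 2 * h ^ (2 * j) / fact (2 * j + 2)" for h j
  have "Ck_on (2 * m + 2) \<Omega> (pd \<Omega> 2 0 \<phi>)"
    by (rule Ck_on_pd[OF assms]) simp
  then obtain C where C: "\<And>h x y. h > 0 \<Longrightarrow> {x} \<times> {y - h, y, y + h} \<subseteq> \<Omega> \<Longrightarrow>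
      \<bar>delta2y h (pd \<Omega> 2 0 \<phi>) (x, y)
        - (\<Sum>j<m. \<gamma> h j * pd \<Omega> 0 (2 * j + 2) (pd \<Omega> 2 0 \<phi>) (x, y))\<bar> \<le> C * h ^ (2 * m)"
    unfolding \<gamma>_def using delta2y_expansion[of m "pd \<Omega> 2 0 \<phi>"] by blast
  have "\<bar>delta2x h (delta2y h \<phi>) (x, y)
      - (\<Sum>j<m. \<gamma> h j * delta2x h (pd \<Omega> 0 (2 * j + 2) \<phi>) (x, y))\<bar> \<le> 2 * C * h ^ (2 * m)"
    if h: "h > 0" and xy: "{x - h, x, x + h} \<times> {y - h, y, y + h} \<subseteq> \<Omega>" for h x y
  proof -
    have S: "x - h \<in> {a..b}" "x \<in> {a..b}" "x + h \<in> {a..b}"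
      "y - h \<in> {c..d}" "y \<in> {c..d}" "y + h \<in> {c..d}"
      using xy by (auto simp: Omega)
    define g where "g i t = delta2y h (pd \<Omega> i 0 \<phi>) (t, y)
        - (\<Sum>j<m. \<gamma> h j * pd \<Omega> i (2 * j + 2) \<phi> (t, y))" for i t
    have deriv_pd: "((\<lambda>t. pd \<Omega> r s \<phi> (t, v)) has_real_derivative pd \<Omega> (Suc r) s \<phi> (t, v)) (at t within {a..b})"
      if "t \<in> {a..b}" "v \<in> {c..d}" "r + s < 2 * m + 4" for r s t v
      using that has_pdx[OF has_partials_on_pd[OF assms, of r s], of t v]
      by (auto simp: pd_Suc Omega)
    have deriv: "(g i has_real_derivative g (Suc i) t) (at t within {a..b})"
      if "t \<in> {a..b}" "i \<le> 2 * 0 + 1" for i t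
      unfolding g_def delta2y_def prod.case
      using that S h by (intro DERIV_diff DERIV_sum DERIV_cmult DERIV_cdivide DERIV_add deriv_pd) auto
    have bound: "\<bar>g (2 * 0 + 2) t\<bar> \<le> C * h ^ (2 * m)" if "t \<in> {a..b}" for t
    proof -
      have swap: "pd \<Omega> 2 (2 * j + 2) \<phi> (t, y) = pd \<Omega> 0 (2 * j + 2) (pd \<Omega> 2 0 \<phi>) (t, y)" if "j < m" for j
      proof -
        have "0 + (2 * j + 2) + 2 + 0 \<le> 2 * m + 4" "(t, y) \<in> \<Omega>"
          using that \<open>t \<in> {a..b}\<close> S by (simp_all add: Omega)
        from pd_pd[OF assms this] show ?thesis
          by (simp only: add_0_left add_0_right)
      qed
      have "g 2 t = delta2y h (pd \<Omega> 2 0 \<phi>) (t, y)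
          - (\<Sum>j<m. \<gamma> h j * pd \<Omega> 0 (2 * j + 2) (pd \<Omega> 2 0 \<phi>) (t, y))"
        unfolding g_def using swap by simp
      moreover have "{t} \<times> {y - h, y, y + h} \<subseteq> \<Omega>"
        using that S by (simp add: Omega)
      ultimately show ?thesis
        using C[OF h, of t y] by (simp only: mult_0_right add_0_left)
    qed
    have "delta2x h (delta2y h \<phi>) (x, y) - (\<Sum>j<m. \<gamma> h j * delta2x h (pd \<Omega> 0 (2 * j + 2) \<phi>) (x, y))
        = (g 0 (x - h) - 2 * g 0 x + g 0 (x + h)) / h^2"
    proof -
      have "(\<Sum>j<m. \<gamma> h j * delta2x h (pd \<Omega> 0 (2 * j + 2) \<phi>) (x, y)) =
          ((\<Sum>j<m. \<gamma> h j * pd \<Omega> 0 (2 * j + 2) \<phi> (x - h, y))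
            - 2 * (\<Sum>j<m. \<gamma> h j * pd \<Omega> 0 (2 * j + 2) \<phi> (x, y))
            + (\<Sum>j<m. \<gamma> h j * pd \<Omega> 0 (2 * j + 2) \<phi> (x + h, y))) / h^2"
        unfolding sum_distrib_left sum_subtractf[symmetric] sum.distrib[symmetric] sum_divide_distrib
        by (intro sum.cong) (simp_all add: delta2x_def algebra_simps)
      then show ?thesis
        by (simp add: g_def delta2x_def pd_def diff_divide_distrib add_divide_distrib algebra_simps)
    qed
    then show ?thesis
      using second_difference_expansion[of "{a..b}" 0 g "C * h ^ (2 * m)" x h, OF deriv bound] S h
      by simp
  qed
  then show ?thesis unfolding \<gamma>_def by blast
qed

section \<open>Landau symbols that are uniform over the grid points\<close>

text \<open>
  The limit \<open>h \<rightarrow> 0+\<close> on pairs \<open>(h, p)\<close>, with no condition on \<open>p\<close> except that its stencil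
  of width \<open>h\<close> lies in \<open>\<Omega>\<close>. A bound along this filter is uniform in \<open>p\<close>, and thereby in the
  grid to which \<open>p\<close> belongs.
\<close>

definition stencil_filter :: "(real \<times> real \<times> real) filter" where
  "stencil_filter = inf (filtercomap fst (at_right 0))
     (principal {(h, x, y). {x - h, x, x + h} \<times> {y - h, y, y + h} \<subseteq> \<Omega>})"

lemma eventually_stencil_filter:
  "eventually P stencil_filter \<longleftrightarrow>
    (\<forall>\<^sub>F h in at_right 0. \<forall>x y. {x - h, x, x + h} \<times> {y - h, y, y + h} \<subseteq> \<Omega> \<longrightarrow> P (h, x, y))"
  unfolding stencil_filter_def eventually_inf_principal eventually_filtercomap
  by (auto elim!: eventually_mono)

lemma bigo_stencilI:
  assumes "\<exists>C. \<forall>h>0. \<forall>x y. {x - h, x, x + h} \<times> {y - h, y, y + h} \<subseteq> \<Omega> \<longrightarrow>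
    \<bar>g (h, x, y)\<bar> \<le> C * h ^ k"
  shows "g \<in> O[stencil_filter](\<lambda>z. fst z ^ k)"
proof -
  obtain C where C: "\<And>h x y. h > 0 \<Longrightarrow> {x - h, x, x + h} \<times> {y - h, y, y + h} \<subseteq> \<Omega> \<Longrightarrow>
      \<bar>g (h, x, y)\<bar> \<le> C * h ^ k"
    using assms by blast
  have "\<forall>\<^sub>F h in at_right (0::real). h > 0"
    by (simp add: eventually_at_right_less)
  then have "\<forall>\<^sub>F z in stencil_filter. norm (g z) \<le> C * norm (fst z ^ k)"
    unfolding eventually_stencil_filter
    by eventually_elim (use C in \<open>auto simp: power_abs\<close>)
  then show ?thesis by (rule bigoI)
qed

lemma bigo_delta2x:
  assumes "Ck_on (2 * m + 2) \<Omega> \<phi>"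
  shows "(\<lambda>z. delta2x (fst z) \<phi> (snd z)
      - (\<Sum>j<m. 2 * fst z ^ (2 * j) / fact (2 * j + 2) * pd \<Omega> (2 * j + 2) 0 \<phi> (snd z)))
    \<in> O[stencil_filter](\<lambda>z. fst z ^ (2 * m))"
proof (rule bigo_stencilI, goal_cases)
  case 1
  obtain C where "\<forall>h>0. \<forall>x y. {x - h, x, x + h} \<times> {y} \<subseteq> \<Omega> \<longrightarrow>
    \<bar>delta2x h \<phi> (x, y)
      - (\<Sum>j<m. 2 * h ^ (2 * j) / fact (2 * j + 2) * pd \<Omega> (2 * j + 2) 0 \<phi> (x, y))\<bar> \<le> C * h ^ (2 * m)"
    using delta2x_expansion[OF assms] by blast
  then show ?case by (intro exI[of _ C]) auto
qed

lemma bigo_delta2y: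
  assumes "Ck_on (2 * m + 2) \<Omega> \<phi>"
  shows "(\<lambda>z. delta2y (fst z) \<phi> (snd z)
      - (\<Sum>j<m. 2 * fst z ^ (2 * j) / fact (2 * j + 2) * pd \<Omega> 0 (2 * j + 2) \<phi> (snd z)))
    \<in> O[stencil_filter](\<lambda>z. fst z ^ (2 * m))"
proof (rule bigo_stencilI, goal_cases)
  case 1
  obtain C where "\<forall>h>0. \<forall>x y. {x} \<times> {y - h, y, y + h} \<subseteq> \<Omega> \<longrightarrow>
    \<bar>delta2y h \<phi> (x, y)
      - (\<Sum>j<m. 2 * h ^ (2 * j) / fact (2 * j + 2) * pd \<Omega> 0 (2 * j + 2) \<phi> (x, y))\<bar> \<le> C * h ^ (2 * m)"
    using delta2y_expansion[OF assms] by blast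
  then show ?case by (intro exI[of _ C]) auto
qed

text \<open>
  The factor \<open>h\<^bsup>2j\<^esup>\<close> in front of the expansion of \<open>\<delta>\<^sub>x\<^sup>2 \<partial>\<^sub>y\<^bsup>2j+2\<^esup> \<phi>\<close> permits that expansion to
  stop after \<open>m - j\<close> terms, which keeps the total order of differentiation at \<open>2m + 4\<close>.
\<close>

lemma bigo_delta2x_delta2y:
  assumes "Ck_on (2 * m + 4) \<Omega> \<phi>"
  shows "(\<lambda>z. delta2x (fst z) (delta2y (fst z) \<phi>) (snd z)
      - (\<Sum>j<m. 2 * fst z ^ (2 * j) / fact (2 * j + 2) *
          (\<Sum>i<m - j. 2 * fst z ^ (2 * i) / fact (2 * i + 2) * pd \<Omega> (2 * i + 2) (2 * j + 2) \<phi> (snd z))))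
    \<in> O[stencil_filter](\<lambda>z. fst z ^ (2 * m))"
proof -
  have "(\<lambda>z. delta2x (fst z) (delta2y (fst z) \<phi>) (snd z)
      - (\<Sum>j<m. 2 * fst z ^ (2 * j) / fact (2 * j + 2) * delta2x (fst z) (pd \<Omega> 0 (2 * j + 2) \<phi>) (snd z)))
    \<in> O[stencil_filter](\<lambda>z. fst z ^ (2 * m))" (is "?f \<in> _")
    by (rule bigo_stencilI) (use delta2x_delta2y_expansion[OF assms] in simp)
  moreover have "(\<lambda>z. \<Sum>j<m. 2 * fst z ^ (2 * j) / fact (2 * j + 2) *
      (delta2x (fst z) (pd \<Omega> 0 (2 * j + 2) \<phi>) (snd z)
        - (\<Sum>i<m - j. 2 * fst z ^ (2 * i) / fact (2 * i + 2) * pd \<Omega> (2 * i + 2) (2 * j + 2) \<phi> (snd z))))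
    \<in> O[stencil_filter](\<lambda>z. fst z ^ (2 * m))" (is "?g \<in> _")
  proof (rule big_sum_in_bigo)
    fix j assume "j \<in> {..<m}"
    then have j: "j < m" by simp
    have "Ck_on (2 * (m - j) + 2) \<Omega> (pd \<Omega> 0 (2 * j + 2) \<phi>)"
      using j by (intro Ck_on_pd[OF assms]) simp
    note bigo_delta2x[OF this]
    moreover have "pd \<Omega> r 0 (pd \<Omega> 0 s \<phi>) = pd \<Omega> r s \<phi>" for r s
      by (simp add: pd_def)
    moreover have "(\<lambda>z. 2 * fst z ^ (2 * j) / fact (2 * j + 2)) \<in> O[stencil_filter](\<lambda>z. fst z ^ (2 * j))"
      by (simp del: fact_Suc)
    ultimately have "(\<lambda>z. 2 * fst z ^ (2 * j) / fact (2 * j + 2) *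
      (delta2x (fst z) (pd \<Omega> 0 (2 * j + 2) \<phi>) (snd z)
        - (\<Sum>i<m - j. 2 * fst z ^ (2 * i) / fact (2 * i + 2) * pd \<Omega> (2 * i + 2) (2 * j + 2) \<phi> (snd z))))
      \<in> O[stencil_filter](\<lambda>z. fst z ^ (2 * j) * fst z ^ (2 * (m - j)))"
      by (intro landau_o.big_mult) simp_all
    moreover have "x ^ (2 * j) * x ^ (2 * (m - j)) = x ^ (2 * m)" for x :: real
    proof -
      have "2 * j + 2 * (m - j) = 2 * m" using j by simp
      then show ?thesis by (metis power_add)
    qed
    ultimately show "(\<lambda>z. 2 * fst z ^ (2 * j) / fact (2 * j + 2) *
      (delta2x (fst z) (pd \<Omega> 0 (2 * j + 2) \<phi>) (snd z)
        - (\<Sum>i<m - j. 2 * fst z ^ (2 * i) / fact (2 * i + 2) * pd \<Omega> (2 * i + 2) (2 * j + 2) \<phi> (snd z))))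
      \<in> O[stencil_filter](\<lambda>z. fst z ^ (2 * m))"
      by simp
  qed
  ultimately have "(\<lambda>z. ?f z + ?g z) \<in> O[stencil_filter](\<lambda>z. fst z ^ (2 * m))"
    by (rule sum_in_bigo)
  then show ?thesis
    by (simp add: right_diff_distrib sum_subtractf del: fact_Suc)
qed

lemma bigo_1_power: "(\<lambda>z. fst z ^ k) \<in> O[stencil_filter](\<lambda>z. 1)"
proof (rule bigoI[where c = 1])
  have "\<forall>\<^sub>F h in at_right (0::real). h \<in> {0<..<1}"
    by (rule eventually_at_right_real) simp
  then show "\<forall>\<^sub>F z in stencil_filter. norm (fst z ^ k) \<le> 1 * norm (1 :: real)"
    unfolding eventually_stencil_filter by eventually_elim (auto simp: power_le_one)
qed

lemma bigo_1_pd: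
  assumes "Ck_on n \<Omega> \<phi>" "r + s \<le> n"
  shows "(\<lambda>z. pd \<Omega> r s \<phi> (snd z)) \<in> O[stencil_filter](\<lambda>z. 1)"
proof -
  obtain M where "\<forall>p\<in>\<Omega>. \<bar>pd \<Omega> r s \<phi> p\<bar> \<le> M"
    using pd_bounded[OF assms] by blast
  then have "(\<lambda>z. pd \<Omega> r s \<phi> (snd z)) \<in> O[stencil_filter](\<lambda>z. fst z ^ 0)"
    by (intro bigo_stencilI exI[of _ M]) simp
  then show ?thesis by simp
qed

end

lemma bigo_1_mult:
  fixes f g :: "'a \<Rightarrow> real"
  assumes "f \<in> O[F](\<lambda>_. 1)" "g \<in> O[F](\<lambda>_. 1)"
  shows "(\<lambda>x. f x * g x) \<in> O[F](\<lambda>_. 1)"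
  using landau_o.big_mult[OF assms] by simp

lemma bigo_1_cdivide:
  fixes f :: "'a \<Rightarrow> real"
  assumes "f \<in> O[F](\<lambda>_. 1)"
  shows "(\<lambda>x. f x / k) \<in> O[F](\<lambda>_. 1)"
  using bigo_1_mult[OF assms bigo_const[of "inverse k"]] by (simp add: divide_inverse)

section \<open>The polynomial identity behind the scheme\<close>

text \<open>
  The exact cofactor of \<open>h\<^sup>8\<close> in the identity below, with \<open>U r s\<close> in place of
  \<open>\<partial>\<^sub>x\<^sup>r \<partial>\<^sub>y\<^sup>s u\<close>. Every term carries a factor \<open>K\<^sup>2\<close>: the truncated series satisfy
  the identity without remainder when \<open>K = 0\<close>.
\<close>

definition residual :: "real \<Rightarrow> real \<Rightarrow> (nat \<Rightarrow> nat \<Rightarrow> real) \<Rightarrow> real" where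
  "residual K h U =
     K^2 * (1 / 241920 * (U 8 0 + U 0 8) + 41 / 3628800 * (U 6 2 + U 2 6) + 1 / 45360 * U 4 4)
     + K^4 * (1 / 241920 * (U 6 0 + U 0 6) + 1 / 120960 * (U 4 2 + U 2 4))
     + K^6 * (1 / 241920 * (U 4 0 + U 0 4))
     + h^2 * (K^4 * (1 / 1814400 * (U 6 2 + U 2 6) + 1 / 725760 * U 4 4)
         + K^6 * (1 / 7257600 * (U 6 0 + U 0 6)))
     + h^4 * (K^6 * (1 / 406425600 * (U 8 0 + U 0 8)))"

text \<open>
  The left-hand side and the \<open>\<beta>\<close> terms contain the truncated Taylor series of the difference
  operators; \<open>U\<close> and \<open>F\<close> stand for the derivatives of \<open>u\<close> and \<open>f\<close>. The derivatives of
  \<open>u\<close> serve as independent variables, which turns the identity into one between polynomials.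
\<close>

lemma symbol_identity:
  fixes K h :: real and U F :: "nat \<Rightarrow> nat \<Rightarrow> real"
  assumes F: "\<And>r s. r + s \<le> 6 \<Longrightarrow> F r s = U (r + 2) s + U r (s + 2) + K^2 * U r s"
  shows "alpha1 K h * ((U 2 0 + h^2 / 12 * U 4 0 + h^4 / 360 * U 6 0 + h^6 / 20160 * U 8 0)
        + (U 0 2 + h^2 / 12 * U 0 4 + h^4 / 360 * U 0 6 + h^6 / 20160 * U 0 8))
      + alpha2 K h * (U 2 2 + h^2 / 12 * (U 4 2 + U 2 4)
          + h^4 / 360 * (U 6 2 + U 2 6) + h^4 / 144 * U 4 4)
      + K^2 * alpha3 K h * U 0 0
    = beta1 K h * F 0 0 + beta2 K h * (F 2 0 + F 0 2)
      + beta3 K h * (F 2 2 + h^2 / 12 * (F 4 2 + F 2 4))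
      + beta4 K h * (F 2 0 + F 0 2)
      + beta5 K h * ((F 4 0 + h^2 / 12 * F 6 0) + (F 0 4 + h^2 / 12 * F 0 6))
      + (h^6 / 3024 * U 4 4 - 11 * h^6 / 60480 * (F 6 0 + F 0 6)
          - 31 * h^6 / 60480 * (F 4 2 + F 2 4))
      + h^8 * residual K h U"
proof -
  have FF: "F 0 0 = U 2 0 + U 0 2 + K^2 * U 0 0" "F 2 0 = U 4 0 + U 2 2 + K^2 * U 2 0"
    "F 0 2 = U 2 2 + U 0 4 + K^2 * U 0 2" "F 2 2 = U 4 2 + U 2 4 + K^2 * U 2 2"
    "F 4 0 = U 6 0 + U 4 2 + K^2 * U 4 0" "F 0 4 = U 2 4 + U 0 6 + K^2 * U 0 4"
    "F 4 2 = U 6 2 + U 4 4 + K^2 * U 4 2" "F 2 4 = U 4 4 + U 2 6 + K^2 * U 2 4"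
    "F 6 0 = U 8 0 + U 6 2 + K^2 * U 6 0" "F 0 6 = U 2 6 + U 0 8 + K^2 * U 0 6"
    by (simp_all add: F eval_nat_numeral)
  \<comment> \<open>Squares as atoms: only even powers of \<open>K\<close> and \<open>h\<close> occur, and the identity is linear in \<open>U\<close>.\<close>
  define k H where "k = K^2" and "H = h^2"
  have pows: "K^2 = k" "K^4 = k * k" "K^6 = k * k * k" "h^2 = H" "h^4 = H * H" "h^6 = H * H * H"
    "h^8 = H * H * H * H"
    by (simp_all add: k_def H_def flip: power_mult power_add)
  show ?thesis
    unfolding FF residual_def alpha1_def alpha2_def alpha3_def
      beta1_def beta2_def beta3_def beta4_def beta5_def pows
    by (simp only: ring_distribs add_divide_distrib diff_divide_distrib
        times_divide_eq_left times_divide_eq_right divide_divide_eq_left mult_1_left mult_1_right mult_ac)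
qed

section \<open>The truncation error\<close>

context closed_rectangle
begin

lemma bigo_power_times:
  assumes "g \<in> O[stencil_filter](\<lambda>_. 1)"
  shows "(\<lambda>z. fst z ^ k * g z) \<in> O[stencil_filter](\<lambda>z. fst z ^ k)"
  using landau_o.big_mult[OF landau_o.big_refl assms] by simp

lemma bigo_power_mult:
  assumes "f \<in> O[stencil_filter](\<lambda>z. fst z ^ i)" "g \<in> O[stencil_filter](\<lambda>z. fst z ^ j)" "i + j = k"
  shows "(\<lambda>z. f z * g z) \<in> O[stencil_filter](\<lambda>z. fst z ^ k)"
  using landau_o.big_mult[OF assms(1,2)] assms(3) by (simp flip: power_add)

lemma bigo_coefficients:
  shows "(\<lambda>z. alpha1 K (fst z)) \<in> O[stencil_filter](\<lambda>z. fst z ^ 0)"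
    and "(\<lambda>z. alpha2 K (fst z)) \<in> O[stencil_filter](\<lambda>z. fst z ^ 2)"
    and "(\<lambda>z. beta2 K (fst z)) \<in> O[stencil_filter](\<lambda>z. fst z ^ 6)"
    and "(\<lambda>z. beta3 K (fst z)) \<in> O[stencil_filter](\<lambda>z. fst z ^ 4)"
    and "(\<lambda>z. beta5 K (fst z)) \<in> O[stencil_filter](\<lambda>z. fst z ^ 4)"
proof -
  note bounded = bigo_const sum_in_bigo bigo_1_cdivide bigo_1_mult bigo_1_power
  have "(\<lambda>z. alpha1 K (fst z)) \<in> O[stencil_filter](\<lambda>_. 1)"
    unfolding alpha1_def by (intro bounded)
  then show "(\<lambda>z. alpha1 K (fst z)) \<in> O[stencil_filter](\<lambda>z. fst z ^ 0)"
    by simp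
  have "alpha2 K h = h ^ 2 * ((1 + K^2 * h^2 / 30 + K^4 * h^4 / 840) / 6)" for h
    by (simp add: alpha2_def)
  then show "(\<lambda>z. alpha2 K (fst z)) \<in> O[stencil_filter](\<lambda>z. fst z ^ 2)"
    by (simp only:) (intro bigo_power_times bounded)
  have "beta2 K h = h ^ 6 * (K^4 / 20160)" for h
    by (simp add: beta2_def)
  then show "(\<lambda>z. beta2 K (fst z)) \<in> O[stencil_filter](\<lambda>z. fst z ^ 6)"
    by (simp only:) (intro bigo_power_times bounded)
  have "beta3 K h = h ^ 4 * ((1 + K^2 * h^2 / 112) / 90)" for h
    by (simp add: beta3_def)
  then show "(\<lambda>z. beta3 K (fst z)) \<in> O[stencil_filter](\<lambda>z. fst z ^ 4)"
    by (simp only:) (intro bigo_power_times bounded)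
  have "beta5 K h = h ^ 4 * ((1 - K^2 * h^2 / 56) / 360)" for h
    by (simp add: beta5_def)
  then show "(\<lambda>z. beta5 K (fst z)) \<in> O[stencil_filter](\<lambda>z. fst z ^ 4)"
    by (simp only:) (intro bigo_power_times bounded)
qed

lemma bigo_residual:
  assumes u: "Ck_on n \<Omega> u" and "n \<ge> 8"
  shows "(\<lambda>z. residual K (fst z) (\<lambda>r s. pd \<Omega> r s u (snd z))) \<in> O[stencil_filter](\<lambda>_. 1)"
  unfolding residual_def using assms(2)
  by (intro bigo_const sum_in_bigo bigo_1_mult bigo_1_power bigo_1_pd[OF u]) simp_all

text \<open>
  The error is the sum of the remainders of all difference operators, each weighted by its
  coefficient, and of \<open>h\<^sup>8\<close> times the residual.
\<close>

lemma truncation_error: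
  assumes u: "Ck_on 10 \<Omega> u" and f: "Ck_on 8 \<Omega> f"
    and eq: "\<And>p. p \<in> \<Omega> \<Longrightarrow> pd \<Omega> 2 0 u p + pd \<Omega> 0 2 u p + K^2 * u p = f p"
  shows "(\<lambda>(h, p). (alpha1 K h * (delta2x h u p + delta2y h u p)
          + alpha2 K h * delta2x h (delta2y h u) p
          + K^2 * alpha3 K h * u p)
        - (beta1 K h * f p
          + beta2 K h * (delta2x h f p + delta2y h f p)
          + beta3 K h * delta2x h (delta2y h f) p
          + beta4 K h * (pd \<Omega> 2 0 f p + pd \<Omega> 0 2 f p)
          + beta5 K h * (delta2x h (pd \<Omega> 2 0 f) p + delta2y h (pd \<Omega> 0 2 f) p)
          + leading_error \<Omega> u f h p)) \<in> O[stencil_filter](\<lambda>z. fst z ^ 8)"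
    (is "?total \<in> _")
proof -
  have sums: "sum g {..<1} = g 0" "sum g {..<2} = g 0 + g 1" "sum g {..<3} = g 0 + g 1 + g 2"
    "sum g {..<4} = g 0 + g 1 + g 2 + g 3" for g :: "nat \<Rightarrow> real"
    by (simp_all add: eval_nat_numeral)
  \<comment> \<open>To meet the literals in the indices of \<open>pd\<close>, the default rewriting of \<open>n + 2\<close> and of \<open>1\<close>
    to successors is switched off below.\<close>
  note eval = sums fact_numeral
  \<comment> \<open>The truncated series that replace the difference quotients.\<close>
  define ux where "ux z = pd \<Omega> 2 0 u (snd z) + fst z ^ 2 / 12 * pd \<Omega> 4 0 u (snd z)
    + fst z ^ 4 / 360 * pd \<Omega> 6 0 u (snd z) + fst z ^ 6 / 20160 * pd \<Omega> 8 0 u (snd z)" for z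
  have ux: "(\<lambda>z. delta2x (fst z) u (snd z) - ux z) \<in> O[stencil_filter](\<lambda>z. fst z ^ 8)"
    using bigo_delta2x[of 4 u] u
    by (simp add: eval ux_def del: add_2_eq_Suc add_2_eq_Suc' One_nat_def)
  define uy where "uy z = pd \<Omega> 0 2 u (snd z) + fst z ^ 2 / 12 * pd \<Omega> 0 4 u (snd z)
    + fst z ^ 4 / 360 * pd \<Omega> 0 6 u (snd z) + fst z ^ 6 / 20160 * pd \<Omega> 0 8 u (snd z)" for z
  have uy: "(\<lambda>z. delta2y (fst z) u (snd z) - uy z) \<in> O[stencil_filter](\<lambda>z. fst z ^ 8)"
    using bigo_delta2y[of 4 u] u
    by (simp add: eval uy_def del: add_2_eq_Suc add_2_eq_Suc' One_nat_def)
  define uxy where "uxy z = pd \<Omega> 2 2 u (snd z)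
    + fst z ^ 2 / 12 * (pd \<Omega> 4 2 u (snd z) + pd \<Omega> 2 4 u (snd z))
    + fst z ^ 4 / 360 * (pd \<Omega> 6 2 u (snd z) + pd \<Omega> 2 6 u (snd z))
    + fst z ^ 4 / 144 * pd \<Omega> 4 4 u (snd z)" for z
  have uxy: "(\<lambda>z. delta2x (fst z) (delta2y (fst z) u) (snd z) - uxy z)
      \<in> O[stencil_filter](\<lambda>z. fst z ^ 6)"
    using bigo_delta2x_delta2y[of 3 u] u
    by (simp add: eval uxy_def algebra_simps add_divide_distrib
        del: add_2_eq_Suc add_2_eq_Suc' One_nat_def)
  define fx :: "real \<times> real \<times> real \<Rightarrow> real" where "fx z = pd \<Omega> 2 0 f (snd z)" for z
  have f4: "Ck_on (2 * 1 + 2) \<Omega> f" by (rule Ck_on_mono[OF f]) simp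
  from bigo_delta2x[OF f4]
  have fx: "(\<lambda>z. delta2x (fst z) f (snd z) - fx z) \<in> O[stencil_filter](\<lambda>z. fst z ^ 2)"
    by (simp add: eval fx_def del: add_2_eq_Suc add_2_eq_Suc' One_nat_def)
  define fy :: "real \<times> real \<times> real \<Rightarrow> real" where "fy z = pd \<Omega> 0 2 f (snd z)" for z
  from bigo_delta2y[OF f4]
  have fy: "(\<lambda>z. delta2y (fst z) f (snd z) - fy z) \<in> O[stencil_filter](\<lambda>z. fst z ^ 2)"
    by (simp add: eval fy_def del: add_2_eq_Suc add_2_eq_Suc' One_nat_def)
  define fxy where "fxy z = pd \<Omega> 2 2 f (snd z)
    + fst z ^ 2 / 12 * (pd \<Omega> 4 2 f (snd z) + pd \<Omega> 2 4 f (snd z))" for z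
  have fxy: "(\<lambda>z. delta2x (fst z) (delta2y (fst z) f) (snd z) - fxy z)
      \<in> O[stencil_filter](\<lambda>z. fst z ^ 4)"
    using bigo_delta2x_delta2y[of 2 f] f
    by (simp add: eval fxy_def algebra_simps add_divide_distrib
        del: add_2_eq_Suc add_2_eq_Suc' One_nat_def)
  define fxx where "fxx z = pd \<Omega> 4 0 f (snd z) + fst z ^ 2 / 12 * pd \<Omega> 6 0 f (snd z)" for z
  have pd_fx: "pd \<Omega> r 0 (pd \<Omega> 2 0 f) = pd \<Omega> (r + 2) 0 f" for r
    by (simp only: pd_def funpow_add o_apply funpow_0)
  have "Ck_on (2 * 2 + 2) \<Omega> (pd \<Omega> 2 0 f)" by (rule Ck_on_pd[OF f]) simp
  from bigo_delta2x[OF this]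
  have fxx: "(\<lambda>z. delta2x (fst z) (pd \<Omega> 2 0 f) (snd z) - fxx z) \<in> O[stencil_filter](\<lambda>z. fst z ^ 4)"
    by (simp add: eval fxx_def pd_fx del: add_2_eq_Suc add_2_eq_Suc' One_nat_def)
  define fyy where "fyy z = pd \<Omega> 0 4 f (snd z) + fst z ^ 2 / 12 * pd \<Omega> 0 6 f (snd z)" for z
  have pd_fy: "pd \<Omega> 0 s (pd \<Omega> 0 2 f) = pd \<Omega> 0 (s + 2) f" for s
    by (simp only: pd_def funpow_add o_apply funpow_0)
  have "Ck_on (2 * 2 + 2) \<Omega> (pd \<Omega> 0 2 f)" by (rule Ck_on_pd[OF f]) simp
  from bigo_delta2y[OF this]
  have fyy: "(\<lambda>z. delta2y (fst z) (pd \<Omega> 0 2 f) (snd z) - fyy z) \<in> O[stencil_filter](\<lambda>z. fst z ^ 4)"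
    by (simp add: eval fyy_def pd_fy del: add_2_eq_Suc add_2_eq_Suc' One_nat_def)

  have small: "(\<lambda>z. alpha1 K (fst z) * ((delta2x (fst z) u (snd z) - ux z) + (delta2y (fst z) u (snd z) - uy z))
      + alpha2 K (fst z) * (delta2x (fst z) (delta2y (fst z) u) (snd z) - uxy z)
      - beta2 K (fst z) * ((delta2x (fst z) f (snd z) - fx z) + (delta2y (fst z) f (snd z) - fy z))
      - beta3 K (fst z) * (delta2x (fst z) (delta2y (fst z) f) (snd z) - fxy z)
      - beta5 K (fst z) * ((delta2x (fst z) (pd \<Omega> 2 0 f) (snd z) - fxx z)
          + (delta2y (fst z) (pd \<Omega> 0 2 f) (snd z) - fyy z))
      + fst z ^ 8 * residual K (fst z) (\<lambda>r s. pd \<Omega> r s u (snd z)))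
    \<in> O[stencil_filter](\<lambda>z. fst z ^ 8)" (is "?errors \<in> _")
    by (intro sum_in_bigo(1) sum_in_bigo(2)
        bigo_power_mult[OF bigo_coefficients(1) sum_in_bigo(1)[OF ux uy]]
        bigo_power_mult[OF bigo_coefficients(2) uxy]
        bigo_power_mult[OF bigo_coefficients(3) sum_in_bigo(1)[OF fx fy]]
        bigo_power_mult[OF bigo_coefficients(4) fxy]
        bigo_power_mult[OF bigo_coefficients(5) sum_in_bigo(1)[OF fxx fyy]]
        bigo_power_times bigo_residual[OF u]) simp_all
  have "?total (h, p) = ?errors (h, p)" if p: "p \<in> \<Omega>" for h p
  proof -
    have u': "Ck_on (8 + 2) \<Omega> u" using u by simp
    have "pd \<Omega> r s f p = pd \<Omega> (r + 2) s u p + pd \<Omega> r (s + 2) u p + K^2 * pd \<Omega> r s u p"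
      if "r + s \<le> 6" for r s
      by (rule pd_Helmholtz[OF u' _ p eq]) (use that in auto)
    from symbol_identity[of "\<lambda>r s. pd \<Omega> r s f p" "\<lambda>r s. pd \<Omega> r s u p" K h, OF this]
    have "alpha1 K h * (ux (h, p) + uy (h, p)) + alpha2 K h * uxy (h, p) + K^2 * alpha3 K h * u p
      = beta1 K h * f p + beta2 K h * (fx (h, p) + fy (h, p)) + beta3 K h * fxy (h, p)
        + beta4 K h * (pd \<Omega> 2 0 f p + pd \<Omega> 0 2 f p) + beta5 K h * (fxx (h, p) + fyy (h, p))
        + leading_error \<Omega> u f h p + h ^ 8 * residual K h (\<lambda>r s. pd \<Omega> r s u p)"
      unfolding ux_def uy_def uxy_def fx_def fy_def fxy_def fxx_def fyy_def leading_error_def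
        fst_conv snd_conv pd_0_0 .
    then show ?thesis
      by (simp add: algebra_simps)
  qed
  then have "\<forall>\<^sub>F z in stencil_filter. ?total z = ?errors z"
    unfolding eventually_stencil_filter by (intro always_eventually) auto
  from landau_o.big.in_cong[OF this] small show ?thesis
    by (rule iffD2)
qed

lemma leading_error_bounded:
  assumes u: "Ck_on 10 \<Omega> u" and f: "Ck_on 8 \<Omega> f"
  shows "\<exists>C. \<forall>h>0. \<forall>p\<in>\<Omega>. \<bar>leading_error \<Omega> u f h p\<bar> \<le> C * h^6"
proof -
  obtain M1 where M1: "\<forall>p\<in>\<Omega>. \<bar>pd \<Omega> 4 4 u p\<bar> \<le> M1"
    using pd_bounded[OF u, of 4 4] by auto
  obtain M2 where M2: "\<forall>p\<in>\<Omega>. \<bar>pd \<Omega> 6 0 f p\<bar> \<le> M2"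
    using pd_bounded[OF f, of 6 0] by auto
  obtain M3 where M3: "\<forall>p\<in>\<Omega>. \<bar>pd \<Omega> 0 6 f p\<bar> \<le> M3"
    using pd_bounded[OF f, of 0 6] by auto
  obtain M4 where M4: "\<forall>p\<in>\<Omega>. \<bar>pd \<Omega> 4 2 f p\<bar> \<le> M4"
    using pd_bounded[OF f, of 4 2] by auto
  obtain M5 where M5: "\<forall>p\<in>\<Omega>. \<bar>pd \<Omega> 2 4 f p\<bar> \<le> M5"
    using pd_bounded[OF f, of 2 4] by auto
  define C where "C = M1 / 3024 + 11 / 60480 * (M2 + M3) + 31 / 60480 * (M4 + M5)"
  have "\<bar>leading_error \<Omega> u f h p\<bar> \<le> C * h^6" if "p \<in> \<Omega>" for h p
  proof -
    have "leading_error \<Omega> u f h p = leading_error \<Omega> u f 1 p * h^6"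
      by (simp add: leading_error_def algebra_simps)
    moreover have "\<bar>leading_error \<Omega> u f 1 p\<bar> \<le> C"
      using bspec[OF M1 that] bspec[OF M2 that] bspec[OF M3 that] bspec[OF M4 that] bspec[OF M5 that]
      unfolding leading_error_def C_def power_one abs_le_iff by (auto simp: field_simps)
    ultimately show ?thesis
      by (simp add: abs_mult mult_right_mono)
  qed
  then show ?thesis by blast
qed

end

theorem mainTheorem1:
  fixes a b c d K :: real
    and \<Omega> :: "(real \<times> real) set"
    and u f :: "real \<times> real \<Rightarrow> real"
  assumes "a < b" and "c < d"
    and "\<Omega> = {a..b} \<times> {c..d}"
    and "Ck_on 10 \<Omega> u"
    and "Ck_on 8 \<Omega> f"
    and "\<forall>p\<in>\<Omega>. pd \<Omega> 2 0 u p + pd \<Omega> 0 2 u p + K^2 * u p = f p"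
  shows "(\<exists>C. \<forall>\<^sub>F h in at_right 0. \<forall>q. \<forall>p \<in> interior_grid_points q h \<Omega>.
      \<bar>(alpha1 K h * (delta2x h u p + delta2y h u p)
          + alpha2 K h * delta2x h (delta2y h u) p
          + K^2 * alpha3 K h * u p)
        - (beta1 K h * f p
          + beta2 K h * (delta2x h f p + delta2y h f p)
          + beta3 K h * delta2x h (delta2y h f) p
          + beta4 K h * (pd \<Omega> 2 0 f p + pd \<Omega> 0 2 f p)
          + beta5 K h * (delta2x h (pd \<Omega> 2 0 f) p + delta2y h (pd \<Omega> 0 2 f) p)
          + leading_error \<Omega> u f h p)\<bar> \<le> C * h^8)
    \<and> (\<exists>C. \<forall>h>0. \<forall>p\<in>\<Omega>. \<bar>leading_error \<Omega> u f h p\<bar> \<le> C * h^6)"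
proof -
  interpret closed_rectangle a b c d \<Omega>
    by standard fact+
  let ?E = "\<lambda>(h, p). (alpha1 K h * (delta2x h u p + delta2y h u p)
          + alpha2 K h * delta2x h (delta2y h u) p
          + K^2 * alpha3 K h * u p)
        - (beta1 K h * f p
          + beta2 K h * (delta2x h f p + delta2y h f p)
          + beta3 K h * delta2x h (delta2y h f) p
          + beta4 K h * (pd \<Omega> 2 0 f p + pd \<Omega> 0 2 f p)
          + beta5 K h * (delta2x h (pd \<Omega> 2 0 f) p + delta2y h (pd \<Omega> 0 2 f) p)
          + leading_error \<Omega> u f h p)"
  have "?E \<in> O[stencil_filter](\<lambda>z. fst z ^ 8)"
    using assms(4-6) by (intro truncation_error) auto
  then obtain C where "\<forall>\<^sub>F z in stencil_filter. norm (?E z) \<le> C * norm (fst z ^ 8)"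
    by (elim landau_o.bigE)
  then have ev: "\<forall>\<^sub>F h in at_right 0. \<forall>x y. {x - h, x, x + h} \<times> {y - h, y, y + h} \<subseteq> \<Omega> \<longrightarrow>
      norm (?E (h, x, y)) \<le> C * norm (h ^ 8)"
    unfolding eventually_stencil_filter fst_conv .
  have "\<forall>\<^sub>F h in at_right 0. \<forall>q. \<forall>p \<in> interior_grid_points q h \<Omega>. \<bar>?E (h, p)\<bar> \<le> C * h^8"
    using ev
  proof eventually_elim
    case (elim h)
    show ?case
    proof (intro allI ballI)
      fix q p assume "p \<in> interior_grid_points q h \<Omega>"
      moreover obtain x y where p: "p = (x, y)"
        by (rule prod.exhaust)
      ultimately have "{x - h, x, x + h} \<times> {y - h, y, y + h} \<subseteq> uniform_grid q h \<Omega>"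
        by (simp only: interior_grid_points_def mem_Collect_eq prod.case)
      also have "\<dots> \<subseteq> \<Omega>"
        unfolding uniform_grid_def by (rule Int_lower2)
      finally have stencil: "{x - h, x, x + h} \<times> {y - h, y, y + h} \<subseteq> \<Omega>" .
      have "norm (?E (h, x, y)) \<le> C * norm (h ^ 8)"
        using elim stencil by blast
      moreover have "norm (h ^ 8) = h ^ 8"
        by (simp add: power_abs[symmetric])
      ultimately show "\<bar>?E (h, p)\<bar> \<le> C * h^8"
        unfolding p real_norm_def by simp
    qed
  qed
  then show ?thesis
    using leading_error_bounded[OF assms(4,5)] unfolding prod.case by blast
qed

end
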